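(* Let the operators $A$, $\Sigma_0$ and the truth $u^\dagger$ satisfy Assumption B (in the context), and let $\zeta_n$ be the 3DVAR iterates computed from Data Model 1 with $\zeta_0=0$ and parameter $\alpha$. Then there is a constant $C$, independent of $n$, $\gamma$ and $\alpha$, such that for all $n\ge1$ $$\mathbb{E}\|\zeta_n-u^\dagger\|^2\le C\left(\frac{\alpha}{n}\right)^{\frac{2\beta}{1+2\epsilon+2p}}+C\gamma^2\alpha^{-\frac{1+2p}{1+2\epsilon+2p}}.$$ Moreover, there is a constant $C'$, independent of $N$ and $\gamma$, such that for every integer $N\ge2$, if one sets $\alpha=N^{\frac{2\beta}{1+2\epsilon+2\beta+2p}}$ and stops the iteration at $n=N$, then $$\mathbb{E}\|\zeta_N-u^\dagger\|^2\le C'(1+\gamma^2)\,N^{-\frac{2\beta}{1+2\epsilon+2\beta+2p}}\ln N.$$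
   Context: $X,Y$ are Hilbert spaces, $A$ is a compact linear operator from $X$ to $Y$, $u^\dagger\in X$ is a fixed (deterministic) element, $\gamma>0$, $\alpha>0$, and $\|\cdot\|$ is the norm of $X$. $\mathcal{N}(0,\gamma^2 I)$ is the centred Gaussian on $Y$ with covariance $\gamma^2 I$ (Gaussian white noise if $Y$ is infinite dimensional, so that $\mathbb{E}\|F\eta\|^2=\gamma^2\,\mathrm{tr}(FF^* )$ for $\eta\sim\mathcal{N}(0,\gamma^2I)$ and a bounded linear $F:Y\to X$). Data Model 1: $y_n=Au^\dagger+\eta_n$, $n\ge1$, with $\eta_n$ i.i.d. $\mathcal{N}(0,\gamma^2I)$. 3DVAR: given $\zeta_0\in X$, for $n\ge1$ $$\zeta_n=\zeta_{n-1}+\mathcal{K}(y_n-A\zeta_{n-1}),\qquad \mathcal{K}=\Sigma_0A^*(A\Sigma_0A^*+\alpha I)^{-1}.$$ Assumption B: the filter covariance is $C_0=\frac{\gamma^2}{\alpha}\Sigma_0$. The operators $\Sigma_0$ and $A^*A$ have the same eigenfunctions $\{e_i\}_{i\ge1}$ (an orthonormal basis of $X$), with respective eigenvalues $\{\lambda_i\}$ and $\{\kappa_i^2\}$ satisfying $\lambda_i=i^{-1-2\epsilon}$ and $c^{-1}i^{-p}\le\kappa_i\le c\,i^{-p}$ for some $\epsilon>0$, $p>0$, $c\ge1$. The initial mean is $\zeta_0=0$, and the coordinates $u^{\dagger,i}$ of $u^\dagger$ in the basis $\{e_i\}$ satisfy $\sum_{i=1}^\infty(u^{\dagger,i})^2i^{2\beta}<\infty$,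 where $0\le\beta\le1+2\epsilon+p$. *)

theory Defs
  imports "HOL-Probability.Probability"
begin

text \<open>Hilbert spaces are real and are given by the sort
  \<open>{real_inner, complete_space}\<close>; operators are plain functions between such types.\<close>

definition compact_operator ::
    "('x::{real_inner,complete_space} \<Rightarrow> 'y::{real_inner,complete_space}) \<Rightarrow> bool" where
  "compact_operator A \<longleftrightarrow>
     linear A \<and> (\<forall>B. bounded B \<longrightarrow> compact (closure (A ` B)))"

definition orthonormal_basis_on :: "nat set \<Rightarrow> (nat \<Rightarrow> 'x::{real_inner,complete_space}) \<Rightarrow> bool" where
  "orthonormal_basis_on I e \<longleftrightarrow>
     (\<forall>i\<in>I. \<forall>j\<in>I. e i \<bullet> e j = (if i = j then 1 else 0)) \<and> closure (span (e ` I)) = UNIV"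

definition assumption_B ::
    "('x::{real_inner,complete_space} \<Rightarrow> 'y::{real_inner,complete_space}) \<Rightarrow> ('x \<Rightarrow> 'x) \<Rightarrow> 'x
     \<Rightarrow> (nat \<Rightarrow> 'x) \<Rightarrow> (nat \<Rightarrow> real) \<Rightarrow> (nat \<Rightarrow> real)
     \<Rightarrow> real \<Rightarrow> real \<Rightarrow> real \<Rightarrow> real \<Rightarrow> bool" where
  "assumption_B A \<Sigma>\<^sub>0 u e lam kap \<epsilon> p c \<beta> \<longleftrightarrow>
     bounded_linear \<Sigma>\<^sub>0 \<and>
     orthonormal_basis_on {1..} e \<and>
     (\<forall>i\<ge>1. \<Sigma>\<^sub>0 (e i) = lam i *\<^sub>R e i) \<and>
     (\<forall>i\<ge>1. adjoint A (A (e i)) = (kap i)\<^sup>2 *\<^sub>R e i) \<and>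
     \<epsilon> > 0 \<and> p > 0 \<and> c \<ge> 1 \<and>
     (\<forall>i\<ge>1. lam i = real i powr (- 1 - 2 * \<epsilon>)) \<and>
     (\<forall>i\<ge>1. inverse c * real i powr (- p) \<le> kap i \<and> kap i \<le> c * real i powr (- p)) \<and>
     0 \<le> \<beta> \<and> \<beta> \<le> 1 + 2 * \<epsilon> + p \<and>
     (\<lambda>i. (u \<bullet> e i)\<^sup>2 * real i powr (2 * \<beta>)) summable_on {1..}"

text \<open>White noise on an infinite-dimensional space is not a random element of that space, so
  random elements of \<open>'y\<close> in the generalised sense are represented by their pairings with the
  vectors of \<open>'y\<close>: for \<open>Z :: 'y \<Rightarrow> 'w \<Rightarrow> real\<close>, the random variable \<open>Z v\<close> plays the role of the
  inner product of \<open>Z\<close> with \<open>v\<close>. A genuine random element \<open>h\<close> of \<open>'y\<close> corresponds to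
  \<open>\<lambda>v \<omega>. h \<omega> \<bullet> v\<close>.

  \<open>white_noise M \<gamma> Z\<close> is the law \<open>N(0, \<gamma>\<^sup>2 I)\<close>. The case \<open>v = 0\<close> is excluded in the second
  conjunct because \<open>normal_density\<close> is not a density for standard deviation zero; \<open>Z 0 = 0\<close>
  almost surely follows from linearity. Linearity also makes the \<open>Z v\<close> jointly Gaussian.\<close>

definition white_noise ::
    "'w measure \<Rightarrow> real \<Rightarrow> ('y::{real_inner,complete_space} \<Rightarrow> 'w \<Rightarrow> real) \<Rightarrow> bool" where
  "white_noise M \<gamma> Z \<longleftrightarrow>
     (\<forall>v. Z v \<in> borel_measurable M) \<and>
     (\<forall>v. v \<noteq> 0 \<longrightarrow> distributed M lborel (Z v) (normal_density 0 (\<gamma> * norm v))) \<and>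
     (\<forall>a b v w. AE \<omega> in M. Z (a *\<^sub>R v + b *\<^sub>R w) \<omega> = a * Z v \<omega> + b * Z w \<omega>)"

definition iid_white_noise ::
    "'w measure \<Rightarrow> real \<Rightarrow> (nat \<Rightarrow> 'y::{real_inner,complete_space} \<Rightarrow> 'w \<Rightarrow> real) \<Rightarrow> bool" where
  "iid_white_noise M \<gamma> \<eta> \<longleftrightarrow>
     prob_space M \<and>
     (\<forall>n\<ge>1. white_noise M \<gamma> (\<eta> n)) \<and>
     prob_space.indep_vars M (\<lambda>_. \<Pi>\<^sub>M v\<in>UNIV. borel) (\<lambda>n \<omega> v. \<eta> n v \<omega>) {1..}"

definition data_model_1 ::
    "'w measure \<Rightarrow> ('x::{real_inner,complete_space} \<Rightarrow> 'y::{real_inner,complete_space})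
     \<Rightarrow> 'x \<Rightarrow> real \<Rightarrow> (nat \<Rightarrow> 'y \<Rightarrow> 'w \<Rightarrow> real) \<Rightarrow> bool" where
  "data_model_1 M A u \<gamma> y \<longleftrightarrow>
     (\<exists>\<eta>. iid_white_noise M \<gamma> \<eta> \<and> (\<forall>n\<ge>1. \<forall>v \<omega>. y n v \<omega> = A u \<bullet> v + \<eta> n v \<omega>))"

text \<open>\<open>is_image M F Z \<xi>\<close> says that the \<open>'x\<close>-valued random element \<open>\<xi>\<close> is \<open>F Z\<close>, for a
  generalised random element \<open>Z\<close>. If \<open>'x\<close> is separable, this determines \<open>\<xi>\<close> almost surely.
  For white noise \<open>Z\<close> such a \<open>\<xi>\<close> exists when \<open>F\<close> is Hilbert--Schmidt.\<close>

definition is_image ::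
    "'w measure \<Rightarrow> ('y::{real_inner,complete_space} \<Rightarrow> 'x::{real_inner,complete_space})
     \<Rightarrow> ('y \<Rightarrow> 'w \<Rightarrow> real) \<Rightarrow> ('w \<Rightarrow> 'x) \<Rightarrow> bool" where
  "is_image M F Z \<xi> \<longleftrightarrow> (\<forall>x. AE \<omega> in M. \<xi> \<omega> \<bullet> x = Z (adjoint F x) \<omega>)"

definition gain ::
    "('x::{real_inner,complete_space} \<Rightarrow> 'y::{real_inner,complete_space}) \<Rightarrow> ('x \<Rightarrow> 'x) \<Rightarrow> real
     \<Rightarrow> 'y \<Rightarrow> 'x" where
  "gain A \<Sigma>\<^sub>0 \<alpha> = \<Sigma>\<^sub>0 \<circ> adjoint A \<circ> inv (\<lambda>v. A (\<Sigma>\<^sub>0 (adjoint A v)) + \<alpha> *\<^sub>R v)"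

text \<open>The recursion \<open>\<zeta> n = \<zeta> (n - 1) + K (y n - A (\<zeta> (n - 1)))\<close>, started at \<open>\<zeta>\<^sub>0\<close>, with \<open>K\<close>
  applied to the generalised innovation in the sense of \<open>is_image\<close>.\<close>

definition threedvar ::
    "'w measure \<Rightarrow> ('x::{real_inner,complete_space} \<Rightarrow> 'y::{real_inner,complete_space})
     \<Rightarrow> ('x \<Rightarrow> 'x) \<Rightarrow> real \<Rightarrow> (nat \<Rightarrow> 'y \<Rightarrow> 'w \<Rightarrow> real) \<Rightarrow> 'x \<Rightarrow> (nat \<Rightarrow> 'w \<Rightarrow> 'x) \<Rightarrow> bool" where
  "threedvar M A \<Sigma>\<^sub>0 \<alpha> y \<zeta>\<^sub>0 \<zeta> \<longleftrightarrow>
     (\<forall>n. \<zeta> n \<in> borel_measurable M) \<and>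
     (\<forall>\<omega>. \<zeta> 0 \<omega> = \<zeta>\<^sub>0) \<and>
     (\<forall>n\<ge>1. is_image M (gain A \<Sigma>\<^sub>0 \<alpha>)
        (\<lambda>v \<omega>. y n v \<omega> - A (\<zeta> (n - 1) \<omega>) \<bullet> v)
        (\<lambda>\<omega>. \<zeta> n \<omega> - \<zeta> (n - 1) \<omega>))"

definition mean_square :: "'w measure \<Rightarrow> ('w \<Rightarrow> 'x::real_normed_vector) \<Rightarrow> ennreal" where
  "mean_square M Z = (\<integral>\<^sup>+ \<omega>. ennreal ((norm (Z \<omega>))\<^sup>2) \<partial>M)"

end

theory Submission
  imports Defs
begin

text \<open>
  In the common eigenbasis the filter decouples. With \<open>s\<^sub>i = \<lambda>\<^sub>i \<kappa>\<^sub>i\<^sup>2\<close>, the \<open>i\<close>-th coordinate of the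
  error is multiplied in each step by \<open>r\<^sub>i = \<alpha> / (s\<^sub>i + \<alpha>)\<close> and receives the independent noise
  \<open>\<lambda>\<^sub>i / (s\<^sub>i + \<alpha>) \<cdot> \<eta>\<^sub>n (A e\<^sub>i)\<close>. Summing the geometric series, the mean square error is at most
  \<open>\<Sum>\<^sub>i r\<^sub>i\<^sup>2\<^sup>n (u\<^sup>i)\<^sup>2 + \<gamma>\<^sup>2 \<Sum>\<^sub>i \<lambda>\<^sub>i / (s\<^sub>i + \<alpha>)\<close>. The bias sum is controlled by
  \<open>r\<^sub>i\<^sup>n \<le> 1 / (1 + n s\<^sub>i / \<alpha>)\<close>, the variance sum by splitting it where \<open>s\<^sub>i\<close> is of order \<open>\<alpha>\<close>. For the
  second claim the cruder bound \<open>(\<Sum>\<^sub>i \<lambda>\<^sub>i) / \<alpha>\<close> on the variance sum is the better one, since there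
  \<open>\<alpha> \<ge> 1\<close>; it gives the rate even without the logarithm.
\<close>

section \<open>Operators on Hilbert spaces\<close>

text \<open>The representer is found as the minimiser of \<open>J\<close>: if
  \<open>f x = x \<bullet> z\<close> for all \<open>x\<close>, then \<open>J x\<close> is the
  squared distance from \<open>x\<close> to \<open>z\<close> minus the squared norm of
  \<open>z\<close>. Completeness makes a minimising sequence converge.\<close>

lemma riesz_representation:
  fixes f :: "'x::{real_inner,complete_space} \<Rightarrow> real"
  assumes "bounded_linear f"
  shows "\<exists>z. \<forall>x. f x = x \<bullet> z"
proof -
  interpret f: bounded_linear f by fact
  define J where "J x = x \<bullet> x - 2 * f x" for x
  obtain K where K: "\<And>x. norm (f x) \<le> norm x * K"
    using f.bounded by blast
  have J_ge: "J x \<ge> - K\<^sup>2" for x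
  proof -
    have "f x \<le> norm x * K" using K[of x] by simp
    then have "J x \<ge> (norm x)\<^sup>2 - 2 * (norm x * K)" by (simp add: J_def power2_norm_eq_inner)
    moreover have "(norm x - K)\<^sup>2 \<ge> 0" by simp
    ultimately show ?thesis by (simp add: power2_diff)
  qed
  define m where "m = (INF x. J x)"
  have bdd: "bdd_below (range J)" using J_ge by (auto intro!: bdd_belowI)
  have m_le: "m \<le> J x" for x unfolding m_def by (rule cINF_lower[OF bdd]) simp
  \<comment> \<open>Parallelogram law: \<open>J\<close> at the midpoint is at least
    \<open>m\<close>, so two near-minimisers are close to each other.\<close>
  have par: "(dist x y)\<^sup>2 \<le> 2 * J x + 2 * J y - 4 * m" for x y
  proof -
    define z where "z = (1/2) *\<^sub>R (x + y)"
    have "J x + J y = 2 * J z + (dist x y)\<^sup>2 / 2"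
      by (simp add: J_def z_def dist_norm power2_norm_eq_inner f.add f.scale inner_simps inner_commute field_simps)
    with m_le[of z] show ?thesis by simp
  qed
  have "\<exists>x. J x < m + inverse (real (Suc n))" for n
    using cINF_less_iff[OF _ bdd, of "m + inverse (real (Suc n))"] by (auto simp: m_def)
  then obtain X where X: "\<And>n. J (X n) < m + inverse (real (Suc n))" by metis
  have "Cauchy X"
  proof (rule metric_CauchyI)
    fix r :: real assume r: "r > 0"
    \<comment> \<open>Each of the two excesses over \<open>m\<close> enters \<open>par\<close> with
      factor 2, hence the 4.\<close>
    then obtain N where N: "inverse (real (Suc N)) < r\<^sup>2 / 4"
      using reals_Archimedean[of "r\<^sup>2 / 4"] by auto
    have "dist (X a) (X b) < r" if "a \<ge> N" "b \<ge> N" for a b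
    proof -
      have "inverse (real (Suc k)) \<le> inverse (real (Suc N))" if "k \<ge> N" for k
        using that by (intro le_imp_inverse_le) auto
      from this[OF that(1)] this[OF that(2)] have "(dist (X a) (X b))\<^sup>2 < r\<^sup>2"
        using par[of "X a" "X b"] X[of a] X[of b] N by linarith
      then show ?thesis using r by (simp add: power2_less_imp_less)
    qed
    then show "\<exists>N. \<forall>a\<ge>N. \<forall>b\<ge>N. dist (X a) (X b) < r" by blast
  qed
  then obtain z where z: "X \<longlonglongrightarrow> z" using Cauchy_convergent convergent_def by blast
  have "(\<lambda>n. J (X n)) \<longlonglongrightarrow> J z" unfolding J_def by (intro tendsto_intros z f.tendsto)
  moreover have "(\<lambda>n. m + inverse (real (Suc n))) \<longlonglongrightarrow> m + 0"
    by (intro tendsto_add tendsto_const LIMSEQ_inverse_real_of_nat)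
  ultimately have "J z \<le> m + 0"
    by (rule LIMSEQ_le) (use X in \<open>auto intro: less_imp_le\<close>)
  then have Jz: "J z \<le> J x" for x using m_le[of x] by simp
  have "f x = x \<bullet> z" for x
  proof (cases "x = 0")
    case True then show ?thesis by (simp add: f.zero)
  next
    case False
    define d where "d = x \<bullet> z - f x"
    \<comment> \<open>This \<open>t\<close> minimises the quadratic \<open>J (z + t x)\<close>; it
      would lower \<open>J\<close> by \<open>d\<^sup>2 / (x \<bullet> x)\<close>, so minimality of
      \<open>z\<close> forces \<open>d = 0\<close>.\<close>
    define t where "t = - d / (x \<bullet> x)"
    have xx: "x \<bullet> x > 0" using False by simp
    have "J (z + t *\<^sub>R x) = J z + t * (t * (x \<bullet> x)) + 2 * t * d"
      by (simp add: J_def d_def f.add f.scale inner_simps inner_commute algebra_simps)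
    also have "\<dots> = J z - d\<^sup>2 / (x \<bullet> x)"
      using xx by (simp add: t_def power2_eq_square)
    finally have "d\<^sup>2 / (x \<bullet> x) \<le> 0" using Jz[of "z + t *\<^sub>R x"] by simp
    then have "d = 0" using xx by (simp add: divide_le_0_iff)
    then show ?thesis by (simp add: d_def)
  qed
  then show ?thesis by blast
qed

text \<open>\<open>adjoint\<close> is defined by choice, so its characteristic identity becomes
  available only once some function satisfying it exists; Riesz supplies one.\<close>

lemma adjoint_inner:
  fixes f :: "'x::{real_inner,complete_space} \<Rightarrow> 'y::real_inner"
  assumes "bounded_linear f"
  shows "f x \<bullet> y = x \<bullet> adjoint f y"
proof -
  have "\<exists>z. \<forall>x. f x \<bullet> y = x \<bullet> z" for y
    by (rule riesz_representation) (rule bounded_linear_inner_left_comp[OF assms])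
  then obtain g where g: "\<forall>x y. f x \<bullet> y = x \<bullet> g y" by metis
  from adjoint_unique[OF g] g show ?thesis by simp
qed

lemma bounded_linear_adjoint:
  fixes f :: "'x::{real_inner,complete_space} \<Rightarrow> 'y::real_inner"
  assumes "bounded_linear f"
  shows "bounded_linear (adjoint f)"
proof -
  note adj = adjoint_inner[OF assms]
  obtain K where K: "\<And>x. norm (f x) \<le> norm x * K" and "K \<ge> 0"
    using bounded_linear.nonneg_bounded[OF assms] by blast
  show ?thesis
  proof (rule bounded_linear_intro)
    show "adjoint f (a + b) = adjoint f a + adjoint f b" for a b
      by (subst vector_eq_ldot[symmetric]) (simp add: inner_simps adj[symmetric])
    show "adjoint f (r *\<^sub>R a) = r *\<^sub>R adjoint f a" for r a
      by (subst vector_eq_ldot[symmetric]) (simp add: inner_simps adj[symmetric])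
    show "norm (adjoint f y) \<le> norm y * K" for y
    proof -
      let ?z = "adjoint f y"
      \<comment> \<open>Pairing the adjoint image with itself leaves one factor
        \<open>norm ?z\<close> to cancel, so the bound \<open>K\<close> of \<open>f\<close> carries
        over.\<close>
      have "(norm ?z)\<^sup>2 = f ?z \<bullet> y" by (simp add: adj power2_norm_eq_inner)
      also have "\<dots> \<le> norm (f ?z) * norm y" by (rule norm_cauchy_schwarz)
      also have "\<dots> \<le> norm ?z * K * norm y" by (intro mult_right_mono K) simp
      finally have "norm ?z * norm ?z \<le> norm ?z * (norm y * K)"
        by (simp add: power2_eq_square mult_ac)
      then show ?thesis using \<open>K \<ge> 0\<close> by (cases "norm ?z = 0") (auto simp: mult_le_cancel_left)
    qed
  qed
qed

text \<open>Surjectivity: for \<open>t = a / L\<^sup>2\<close> with \<open>L\<close> a bound for \<open>B\<close>, the map \<open>v \<mapsto> v - t (B v - w)\<close> is a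
  contraction, and its fixed point solves \<open>B v = w\<close>.\<close>
lemma coercive_bij:
  fixes B :: "'x::{real_inner,complete_space} \<Rightarrow> 'x"
  assumes "bounded_linear B" and "a > 0" and coer: "\<And>v. B v \<bullet> v \<ge> a * (v \<bullet> v)"
  shows "bij B"
proof -
  interpret B: bounded_linear B by fact
  have zero: "v = 0" if "B v = 0" for v
  proof -
    have "v \<bullet> v \<le> 0" using coer[of v] \<open>a > 0\<close> that by (simp add: mult_le_0_iff)
    then show ?thesis using inner_gt_zero_iff[of v] by linarith
  qed
  have "inj B"
  proof (rule injI)
    fix v w assume "B v = B w"
    then have "B (v - w) = 0" by (simp add: B.diff)
    from zero[OF this] show "v = w" by simp
  qed
  moreover have "\<exists>v. B v = w" for w
  proof -
    obtain L where L: "\<And>x. norm (B x) \<le> norm x * L" "L > 0"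
      using B.pos_bounded by blast
    define t where "t = a / L\<^sup>2"
    have t: "t > 0" using \<open>a > 0\<close> L by (simp add: t_def)
    define q where "q = 1 - a\<^sup>2 / L\<^sup>2"
    have contr: "(norm (v - t *\<^sub>R B v))\<^sup>2 \<le> q * (norm v)\<^sup>2" for v
    proof -
      have "(norm (v - t *\<^sub>R B v))\<^sup>2 = (norm v)\<^sup>2 - 2 * t * (B v \<bullet> v) + t\<^sup>2 * (norm (B v))\<^sup>2"
        unfolding power2_norm_eq_inner by (simp add: inner_simps inner_commute power2_eq_square algebra_simps)
      also have "\<dots> \<le> (norm v)\<^sup>2 - 2 * t * (a * (norm v)\<^sup>2) + t\<^sup>2 * (norm v * L)\<^sup>2"
        using coer[of v] L(1)[of v] t
        by (intro add_mono diff_mono mult_left_mono power_mono) (auto simp: power2_norm_eq_inner)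
      also have "\<dots> = (1 - 2 * t * a + t\<^sup>2 * L\<^sup>2) * (norm v)\<^sup>2"
        by (simp add: power_mult_distrib algebra_simps)
      also have "1 - 2 * t * a + t\<^sup>2 * L\<^sup>2 = q"
        using L(2) by (simp add: t_def q_def field_simps power2_eq_square)
      finally show ?thesis .
    qed
    \<comment> \<open>In a trivial space coercivity does not force \<open>a \<le> L\<close>, so
      \<open>q\<close> may be negative; the truncation keeps \<open>sqrt\<close> meaningful.\<close>
    define q' where "q' = max q 0"
    have q': "0 \<le> q'" "q' < 1" using \<open>a > 0\<close> L by (auto simp: q'_def q_def)
    have "\<exists>!v. v - t *\<^sub>R (B v - w) = v"
    proof (rule banach_fix_type[where c="sqrt q'"])
      show "\<forall>x y.
        dist (x - t *\<^sub>R (B x - w)) (y - t *\<^sub>R (B y - w)) \<le> sqrt q' * dist x y"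
      proof (intro allI)
        fix x y
        have "(norm ((x - y) - t *\<^sub>R B (x - y)))\<^sup>2 \<le> q' * (norm (x - y))\<^sup>2"
          by (rule order_trans[OF contr]) (auto simp: q'_def intro!: mult_right_mono)
        also have "\<dots> = (sqrt q' * norm (x - y))\<^sup>2"
          using q' by (simp add: power_mult_distrib)
        finally have "norm ((x - y) - t *\<^sub>R B (x - y)) \<le> sqrt q' * norm (x - y)"
          by (rule power2_le_imp_le) (use q' in simp)
        then show "dist (x - t *\<^sub>R (B x - w)) (y - t *\<^sub>R (B y - w)) \<le> sqrt q' * dist x y"
          by (simp add: dist_norm B.diff algebra_simps)
      qed
    qed (use q' in auto)
    then obtain v where "v - t *\<^sub>R (B v - w) = v" by blast
    then show ?thesis using t by auto
  qed
  ultimately show ?thesis unfolding bij_def surj_def by metis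
qed

text \<open>The image of the closed unit ball has compact closure and is therefore bounded;
  homogeneity extends the bound to all vectors.\<close>

lemma compact_operator_bounded_linear:
  assumes "compact_operator A"
  shows "bounded_linear A"
proof -
  have lin: "linear A" and cpt: "compact (closure (A ` cball 0 1))"
    using assms by (auto simp: compact_operator_def)
  from cpt have "bounded (A ` cball 0 1)"
    by (meson bounded_subset closure_subset compact_imp_bounded)
  then obtain K where "\<forall>x\<in>cball 0 1. norm (A x) \<le> K"
    by (auto simp: bounded_iff)
  then have K: "norm (A x) \<le> K" if "norm x \<le> 1" for x
    using that by simp
  interpret linear A by fact
  show ?thesis
  proof (rule bounded_linear_intro)
    show "norm (A x) \<le> norm x * K" for x
    proof (cases "x = 0")
      case False
      have "norm (A (x /\<^sub>R norm x)) \<le> K" using False by (intro K) simp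
      then show ?thesis using False by (simp add: scale field_simps)
    qed (simp add: zero)
  qed (simp_all add: add scale)
qed

text \<open>The adjoint is needed because \<open>is_image\<close> reads off coordinates through it.
  With \<open>B = A S A* + \<alpha> I\<close> coercive and symmetric, the adjoint of the gain
  \<open>S A* B^{-1}\<close> is \<open>B^{-1} A S\<close>, and \<open>A e\<close> is an eigenvector
  of \<open>B\<close> for the eigenvalue \<open>l * k + \<alpha>\<close>.\<close>

lemma adjoint_gain_eigenvector:
  fixes A :: "'x::{real_inner,complete_space} \<Rightarrow> 'y::{real_inner,complete_space}"
  assumes A: "bounded_linear A" and S: "bounded_linear S"
    and sym: "\<And>x y. S x \<bullet> y = x \<bullet> S y" and pos: "\<And>x. S x \<bullet> x \<ge> 0"
    and "\<alpha> > 0"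
    and e: "S e = l *\<^sub>R e" "adjoint A (A e) = k *\<^sub>R e" and "l * k \<ge> 0"
  shows "adjoint (gain A S \<alpha>) e = (l / (l * k + \<alpha>)) *\<^sub>R A e"
proof -
  note adjA = adjoint_inner[OF A] and blA = bounded_linear_adjoint[OF A]
  have adjA': "y \<bullet> A x = adjoint A y \<bullet> x" for x y
    using adjA[of x y] by (simp add: inner_commute)
  define B where "B v = A (S (adjoint A v)) + \<alpha> *\<^sub>R v" for v
  have B: "bounded_linear B"
    unfolding B_def
    by (intro bounded_linear_add bounded_linear_scaleR_right
        bounded_linear_compose[OF A] bounded_linear_compose[OF S] blA)
  interpret B: bounded_linear B by fact
  have "\<alpha> * (v \<bullet> v) \<le> B v \<bullet> v" for v
    using pos[of "adjoint A v"] by (simp add: B_def inner_add_left adjA)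
  from coercive_bij[OF B \<open>\<alpha> > 0\<close> this] have bij: "bij B" .
  have symB: "B v \<bullet> w = v \<bullet> B w" for v w
    by (simp add: B_def inner_add_left inner_add_right adjA adjA' sym)
  have "gain A S \<alpha> v \<bullet> x = v \<bullet> inv B (A (S x))" for v x
  proof -
    have "gain A S \<alpha> v \<bullet> x = S (adjoint A (inv B v)) \<bullet> x"
      by (simp add: gain_def B_def[abs_def])
    also have "\<dots> = inv B v \<bullet> A (S x)"
      by (simp add: sym adjA')
    \<comment> \<open>Inserting \<open>B (inv B _)\<close> lets the symmetry of \<open>B\<close> act
      as symmetry of its inverse.\<close>
    also have "\<dots> = inv B v \<bullet> B (inv B (A (S x)))"
      using bij by (simp add: bij_is_surj surj_f_inv_f)
    also have "\<dots> = B (inv B v) \<bullet> inv B (A (S x))"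
      by (rule symB[symmetric])
    also have "\<dots> = v \<bullet> inv B (A (S x))"
      using bij by (simp add: bij_is_surj surj_f_inv_f)
    finally show ?thesis .
  qed
  then have adj: "adjoint (gain A S \<alpha>) = (\<lambda>x. inv B (A (S x)))"
    by (intro adjoint_unique) blast
  interpret A: bounded_linear A by fact
  interpret S: bounded_linear S by fact
  have "l * k + \<alpha> > 0" using assms by linarith
  moreover have "B (A e) = (l * k + \<alpha>) *\<^sub>R A e"
    by (simp add: B_def e S.scale A.scale scaleR_add_left mult_ac)
  ultimately have "B ((l / (l * k + \<alpha>)) *\<^sub>R A e) = A (S e)"
    by (simp add: B.scale e A.scale)
  then show ?thesis using bij_inv_eq_iff[OF bij] adj by metis
qed

section \<open>Orthonormal bases\<close>

text \<open>The partial sums are orthogonal projections. They eventually fix each vector of the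
  span, and their complements do not increase norms, so convergence passes from the dense span to
  every vector. Parseval follows by pairing with \<open>x\<close>.\<close>

lemma
  fixes e :: "nat \<Rightarrow> 'x::{real_inner,complete_space}"
  assumes onb: "orthonormal_basis_on {1..} e"
  shows orthonormal_basis_expansion: "(\<lambda>n. \<Sum>i=1..n. (x \<bullet> e i) *\<^sub>R e i) \<longlonglongrightarrow> x"
    and parseval: "(\<lambda>i. (x \<bullet> e (Suc i))\<^sup>2) sums (norm x)\<^sup>2"
proof -
  define S where "S n x = (\<Sum>i=1..n. (x \<bullet> e i) *\<^sub>R e i)" for n x
  have on: "e i \<bullet> e j = (if i = j then 1 else 0)" if "i \<ge> 1" "j \<ge> 1" for i j
    using onb that by (auto simp: orthonormal_basis_on_def)
  have cl: "closure (span (e ` {1..})) = UNIV"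
    using onb by (simp add: orthonormal_basis_on_def)
  have S_e: "S n x \<bullet> e j = x \<bullet> e j" if "j \<in> {1..n}" for n x j
  proof -
    have "S n x \<bullet> e j = (\<Sum>i=1..n. if i = j then x \<bullet> e i else 0)"
      unfolding S_def inner_sum_left by (rule sum.cong) (use that in \<open>auto simp: on\<close>)
    then show ?thesis using that by (simp add: sum.delta')
  qed
  have S_inner: "S n x \<bullet> y = (\<Sum>i=1..n. (x \<bullet> e i) * (y \<bullet> e i))" for n x y
    unfolding S_def inner_sum_left by (simp add: inner_commute)
  have SS: "S n x \<bullet> S n x = S n x \<bullet> x" for n x
    unfolding S_inner[of n x "S n x"] S_inner[of n x x] by (rule sum.cong) (simp_all add: S_e)
  have norm_S: "norm (x - S n x) \<le> norm x" for n x
  proof (rule power2_le_imp_le)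
    have "(norm (x - S n x))\<^sup>2 = (norm x)\<^sup>2 - S n x \<bullet> S n x"
      using SS[of n x] by (simp add: power2_norm_eq_inner inner_diff_left inner_diff_right inner_commute)
    then show "(norm (x - S n x))\<^sup>2 \<le> (norm x)\<^sup>2" by simp
  qed simp
  have S_add: "S n (x + y) = S n x + S n y" and S_scale: "S n (c *\<^sub>R x) = c *\<^sub>R S n x" for n x y c
    by (simp_all add: S_def inner_add_left scaleR_add_left sum.distrib scaleR_sum_right)
  have fin: "\<exists>N. \<forall>n\<ge>N. S n v = v" if "v \<in> span (e ` {1..})" for v
    using that
  proof (induction rule: span_induct_alt)
    case base
    show ?case by (simp add: S_def)
  next
    case (step c v y)
    then obtain N j where N: "\<forall>n\<ge>N. S n y = y" and j: "v = e j" "j \<ge> 1" by auto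
    have "S n (e j) = e j" if "n \<ge> j" for n
    proof -
      have "S n (e j) = (\<Sum>i=1..n. if i = j then e i else 0)"
        unfolding S_def by (rule sum.cong) (use j in \<open>auto simp: on\<close>)
      then show ?thesis using that j by (simp add: sum.delta')
    qed
    with N j have "\<forall>n\<ge>max N j. S n (c *\<^sub>R v + y) = c *\<^sub>R v + y"
      by (simp add: S_add S_scale)
    then show ?case by blast
  qed
  have lim: "(\<lambda>n. S n x) \<longlonglongrightarrow> x" for x
  proof (rule LIMSEQ_I)
    fix r :: real assume "r > 0"
    moreover have "x \<in> closure (span (e ` {1..}))" using cl by simp
    ultimately obtain v where v: "v \<in> span (e ` {1..})" "dist v x < r"
      unfolding closure_approachable by blast
    from fin[OF v(1)] obtain N where N: "\<forall>n\<ge>N. S n v = v" by blast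
    have "norm (S n x - x) < r" if "n \<ge> N" for n
    proof -
      \<comment> \<open>Since \<open>S n\<close> fixes \<open>v\<close>, the error at
        \<open>x\<close> equals the error at \<open>x - v\<close>, which is small.\<close>
      have "x = (x - v) + v" by simp
      then have "S n x = S n (x - v) + v" using S_add N that by metis
      then have "norm (S n x - x) = norm ((x - v) - S n (x - v))"
        by (simp add: norm_minus_commute algebra_simps)
      also have "\<dots> \<le> norm (x - v)" by (rule norm_S)
      finally show ?thesis using v(2) by (simp add: dist_norm norm_minus_commute)
    qed
    then show "\<exists>N. \<forall>n\<ge>N. norm (S n x - x) < r" by blast
  qed
  from lim show "(\<lambda>n. \<Sum>i=1..n. (x \<bullet> e i) *\<^sub>R e i) \<longlonglongrightarrow> x" by (simp add: S_def)
  have "(\<lambda>n. S n x \<bullet> x) \<longlonglongrightarrow> x \<bullet> x" by (intro tendsto_intros lim)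
  moreover have "S n x \<bullet> x = (\<Sum>i<n. (x \<bullet> e (Suc i))\<^sup>2)" for n
    unfolding S_def inner_sum_left
    by (rule sum.reindex_bij_witness[of _ Suc "\<lambda>i. i - 1"]) (auto simp: power2_eq_square inner_commute)
  ultimately show "(\<lambda>i. (x \<bullet> e (Suc i))\<^sup>2) sums (norm x)\<^sup>2"
    by (simp add: sums_def power2_norm_eq_inner)
qed

text \<open>Assumption B gives only boundedness and eigenpairs of the covariance. Self-adjointness
  and positivity come from expanding \<open>x\<close>: the form \<open>S x \<bullet> y\<close> is a
  limit of finite sums symmetric in \<open>x\<close> and \<open>y\<close>.\<close>

lemma
  fixes e :: "nat \<Rightarrow> 'x::{real_inner,complete_space}"
  assumes onb: "orthonormal_basis_on {1..} e"
    and S: "bounded_linear S" and eig: "\<And>i. i \<ge> 1 \<Longrightarrow> S (e i) = lam i *\<^sub>R e i"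
  shows diagonal_operator_symmetric: "S x \<bullet> y = x \<bullet> S y"
    and diagonal_operator_nonneg: "(\<And>i. i \<ge> 1 \<Longrightarrow> lam i \<ge> 0) \<Longrightarrow> S x \<bullet> x \<ge> 0"
proof -
  interpret S: bounded_linear S by fact
  have lim: "(\<lambda>n. \<Sum>i=1..n. lam i * (x \<bullet> e i) * (y \<bullet> e i)) \<longlonglongrightarrow> S x \<bullet> y" for x y
  proof -
    have "(\<lambda>n. S (\<Sum>i=1..n. (x \<bullet> e i) *\<^sub>R e i) \<bullet> y) \<longlonglongrightarrow> S x \<bullet> y"
      by (intro tendsto_intros S.tendsto orthonormal_basis_expansion[OF onb])
    moreover have "S (\<Sum>i=1..n. (x \<bullet> e i) *\<^sub>R e i) \<bullet> y = (\<Sum>i=1..n. lam i * (x \<bullet> e i) * (y \<bullet> e i))" for n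
      unfolding S.sum inner_sum_left by (rule sum.cong) (auto simp: S.scale eig inner_commute)
    ultimately show ?thesis by simp
  qed
  have "(\<lambda>n. \<Sum>i=1..n. lam i * (x \<bullet> e i) * (y \<bullet> e i)) \<longlonglongrightarrow> x \<bullet> S y"
    using lim[of y x] by (simp add: mult_ac inner_commute)
  with lim[of x y] show "S x \<bullet> y = x \<bullet> S y" by (rule LIMSEQ_unique)
  show "S x \<bullet> x \<ge> 0" if "\<And>i. i \<ge> 1 \<Longrightarrow> lam i \<ge> 0"
    by (rule LIMSEQ_le_const[OF lim]) (use that in \<open>auto intro!: sum_nonneg simp: mult.assoc\<close>)
qed

section \<open>Power sums\<close>

text \<open>Integral comparison: the mean value theorem bounds each term by a difference of values
  of the antiderivative, and these differences telescope.\<close>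

lemma sum_powr_tail_le:
  fixes a :: real
  assumes "a > 1" "k \<ge> (1::nat)"
  shows "(\<Sum>i\<in>{k<..n}. real i powr (-a)) \<le> real k powr (1 - a) / (a - 1)"
proof -
  have step: "(a - 1) * real (Suc m) powr (-a) \<le> real m powr (1 - a) - real (Suc m) powr (1 - a)"
    if "m \<ge> 1" for m :: nat
  proof -
    have "\<exists>z>real m. z < real (Suc m) \<and>
        real (Suc m) powr (1 - a) - real m powr (1 - a) = (real (Suc m) - real m) * ((1 - a) * z powr (-a))"
    proof (rule MVT2)
      fix x assume "real m \<le> x" "x \<le> real (Suc m)"
      then have "x > 0" using that by linarith
      then show "((\<lambda>x. x powr (1 - a)) has_real_derivative (1 - a) * x powr (-a)) (at x)"
        by (auto intro!: derivative_eq_intros)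
    qed simp
    then obtain z where z: "real m < z" "z < real (Suc m)"
      "real (Suc m) powr (1 - a) - real m powr (1 - a) = (1 - a) * z powr (-a)" by auto
    have "real (Suc m) powr (-a) \<le> z powr (-a)"
      using z that assms by (intro powr_mono2') auto
    then have "(a - 1) * real (Suc m) powr (-a) \<le> (a - 1) * z powr (-a)"
      using assms by (intro mult_left_mono) auto
    then show ?thesis using z(3) by (simp add: algebra_simps)
  qed
  \<comment> \<open>\<open>max k n\<close> keeps the telescoped bound true for \<open>n < k\<close>,
    where the sum is empty, so the induction can start at 0.\<close>
  have "(a - 1) * (\<Sum>i\<in>{k<..n}. real i powr (-a)) \<le> real k powr (1 - a) - real (max k n) powr (1 - a)"
  proof (induction n)
    case 0
    then show ?case by simp
  next
    case (Suc n)
    show ?case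
    proof (cases "k \<le> n")
      case True
      then have "{k<..Suc n} = insert (Suc n) {k<..n}" by auto
      moreover have "max k n = n" "max k (Suc n) = Suc n" using True by auto
      ultimately show ?thesis using Suc step[of n] True assms by (simp add: distrib_left)
    next
      case False
      then have "{k<..Suc n} = {}" "max k (Suc n) = k" by auto
      then show ?thesis by simp
    qed
  qed
  also have "\<dots> \<le> real k powr (1 - a)" by simp
  finally show ?thesis using assms by (simp add: field_simps)
qed

lemma sum_powr_le:
  fixes a :: real
  assumes "a > 1"
  shows "(\<Sum>i=1..n. real i powr (-a)) \<le> 1 + 1 / (a - 1)"
proof (cases "n = 0")
  case False
  then have "{1..n} = insert 1 {1<..n}" by auto
  then show ?thesis using sum_powr_tail_le[OF assms, of 1 n] by simp
qed (use assms in simp)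

text \<open>The two branches of the minimum cross at \<open>i = \<alpha> powr (- 1 / (a + q))\<close>, where the sum is split.\<close>
lemma sum_min_powr_le:
  fixes a q \<alpha> :: real
  assumes "a > 1" "q \<ge> 0" "\<alpha> > 0"
  shows "(\<Sum>i=1..n. min (real i powr q) (real i powr (-a) / \<alpha>))
    \<le> (1 + 2 powr (a - 1) / (a - 1)) * \<alpha> powr (- ((q + 1) / (a + q)))"
\<comment> \<open>For \<open>\<alpha> \<ge> 1\<close> the crossing point is at most 1, so the second
  branch alone suffices; \<open>(q + 1) / (a + q) \<le> 1\<close> then weakens the power of
  \<open>\<alpha>\<close>.\<close>
proof (cases "\<alpha> \<ge> 1")
  case True
  have "(\<Sum>i=1..n. min (real i powr q) (real i powr (-a) / \<alpha>)) \<le> (\<Sum>i=1..n. real i powr (-a)) / \<alpha>"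
    unfolding sum_divide_distrib by (intro sum_mono) simp
  also have "\<dots> \<le> (1 + 1 / (a - 1)) / \<alpha>"
    using assms by (intro divide_right_mono sum_powr_le) auto
  also have "\<dots> = (1 + 1 / (a - 1)) * \<alpha> powr (- 1)"
    using assms by (simp add: powr_minus divide_inverse)
  also have "\<dots> \<le> (1 + 2 powr (a - 1) / (a - 1)) * \<alpha> powr (- ((q + 1) / (a + q)))"
  proof (intro mult_mono powr_mono True)
    show "1 + 1 / (a - 1) \<le> 1 + 2 powr (a - 1) / (a - 1)"
      using assms by (intro add_left_mono divide_right_mono ge_one_powr_ge_zero) auto
    show "- 1 \<le> - ((q + 1) / (a + q))" using assms by (simp add: divide_le_eq)
  qed (use assms in \<open>auto intro: add_nonneg_nonneg\<close>)
  finally show ?thesis .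
next
  case False
  define m where "m = \<alpha> powr (- 1 / (a + q))"
  define k where "k = nat \<lfloor>m\<rfloor>"
  have m1: "m \<ge> 1"
    using powr_mono'[of "- 1 / (a + q)" 0 \<alpha>] assms False by (simp add: m_def)
  then have k: "k \<ge> 1" "real k \<le> m" "m < real k + 1" unfolding k_def by linarith+
  \<comment> \<open>Rounding \<open>m \<ge> 1\<close> down loses at most a factor 2, which becomes
    \<open>2 powr (a - 1)\<close> in the tail.\<close>
  then have half: "m / 2 \<le> real k" by linarith
  have m_powr: "m powr (q + 1) = \<alpha> powr (- ((q + 1) / (a + q)))"
    by (simp add: m_def powr_powr)
  have m_alpha: "m powr (a + q) = 1 / \<alpha>"
    unfolding m_def powr_powr using assms by (simp add: powr_minus_divide)
  have head: "(\<Sum>i=1..k. min (real i powr q) (real i powr (-a) / \<alpha>)) \<le> m powr (q + 1)"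
  proof -
    have "(\<Sum>i=1..k. min (real i powr q) (real i powr (-a) / \<alpha>)) \<le> (\<Sum>i=1..k. m powr q)"
      using k assms by (intro sum_mono min.coboundedI1 powr_mono2) auto
    also have "\<dots> \<le> m * m powr q" using k by (simp add: mult_right_mono)
    also have "\<dots> = m powr (q + 1)" using m1 by (simp add: powr_add)
    finally show ?thesis .
  qed
  have tail: "(\<Sum>i\<in>{k<..n}. min (real i powr q) (real i powr (-a) / \<alpha>))
      \<le> 2 powr (a - 1) / (a - 1) * m powr (q + 1)"
  proof -
    have "(\<Sum>i\<in>{k<..n}. min (real i powr q) (real i powr (-a) / \<alpha>))
        \<le> (\<Sum>i\<in>{k<..n}. real i powr (-a)) / \<alpha>"
      unfolding sum_divide_distrib by (intro sum_mono) simp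
    also have "\<dots> \<le> real k powr (1 - a) / (a - 1) / \<alpha>"
      using assms k by (intro divide_right_mono sum_powr_tail_le) auto
    also have "\<dots> \<le> (m / 2) powr (1 - a) / (a - 1) / \<alpha>"
      using assms m1 half by (intro divide_right_mono powr_mono2') auto
    also have "(m / 2) powr (1 - a) = m powr (1 - a) * 2 powr (a - 1)"
      using m1 powr_minus_divide[of 2 "a - 1"] by (simp add: powr_divide)
    also have "\<dots> / (a - 1) / \<alpha> = 2 powr (a - 1) / (a - 1) * (m powr (1 - a) * m powr (a + q))"
      by (simp add: m_alpha)
    also have "m powr (1 - a) * m powr (a + q) = m powr (q + 1)"
      by (simp add: powr_add[symmetric] add_ac)
    finally show ?thesis .
  qed
  \<comment> \<open>\<open>n\<close> may be smaller than \<open>k\<close>, so the index set is first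
    enlarged; all terms are nonnegative.\<close>
  have "(\<Sum>i=1..n. min (real i powr q) (real i powr (-a) / \<alpha>))
     \<le> (\<Sum>i\<in>{1..k} \<union> {k<..n}. min (real i powr q) (real i powr (-a) / \<alpha>))"
    using assms by (intro sum_mono2) auto
  also have "\<dots> = (\<Sum>i=1..k. min (real i powr q) (real i powr (-a) / \<alpha>))
     + (\<Sum>i\<in>{k<..n}. min (real i powr q) (real i powr (-a) / \<alpha>))"
    by (intro sum.union_disjoint) auto
  also have "\<dots> \<le> (1 + 2 powr (a - 1) / (a - 1)) * m powr (q + 1)"
    using head tail by (simp add: distrib_right)
  finally show ?thesis by (simp add: m_powr)
qed

text \<open>Bernoulli's inequality, and interpolation between the exponents 0 and 2.\<close>
lemma contraction_power_le_powr:
  fixes s \<alpha> \<theta> :: real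
  assumes "s > 0" "\<alpha> > 0" "n \<ge> 1" "0 \<le> \<theta>" "\<theta> \<le> 2"
  shows "(\<alpha> / (s + \<alpha>)) ^ (2 * n) \<le> (\<alpha> / real n) powr \<theta> * s powr (- \<theta>)"
proof -
  define t where "t = real n * s / \<alpha>"
  have t: "t > 0" using assms by (simp add: t_def)
  have "1 + real n * (s / \<alpha>) \<le> (1 + s / \<alpha>) ^ n"
    using assms by (intro Bernoulli_inequality) (auto intro: order_trans[of _ 0])
  then have t_le: "1 + t \<le> ((s + \<alpha>) / \<alpha>) ^ n" using assms by (simp add: t_def field_simps)
  have "t powr \<theta> \<le> (1 + t) powr \<theta>" using t assms by (intro powr_mono2) auto
  \<comment> \<open>The exponent can go no higher than 2 because the factor occurs to the power
    \<open>2 * n\<close>, that is, as two copies of Bernoulli's bound.\<close>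
  also have "\<dots> \<le> (1 + t) powr 2" using t assms by (intro powr_mono) auto
  also have "\<dots> = (1 + t)\<^sup>2" using t by simp
  also have "\<dots> \<le> (((s + \<alpha>) / \<alpha>) ^ n)\<^sup>2" using t_le t by (intro power_mono) auto
  also have "\<dots> = ((s + \<alpha>) / \<alpha>) ^ (2 * n)" by (simp add: power_mult[symmetric] mult.commute)
  finally have "inverse (((s + \<alpha>) / \<alpha>) ^ (2 * n)) \<le> inverse (t powr \<theta>)"
    using t by (intro le_imp_inverse_le) auto
  also have "inverse (t powr \<theta>) = (inverse t) powr \<theta>"
    by (simp add: powr_def ln_inverse exp_minus t)
  also have "inverse t = (\<alpha> / real n) * inverse s"
    using assms by (simp add: t_def field_simps)
  also have "\<dots> powr \<theta> = (\<alpha> / real n) powr \<theta> * s powr (- \<theta>)"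
    using assms by (subst powr_mult) (auto simp: powr_def ln_inverse)
  finally show ?thesis by (simp add: power_inverse[symmetric])
qed

section \<open>The error of the 3DVAR iterates\<close>

text \<open>Expanding the square about the mean reduces it to the central moments of orders 2, 1 and
  0.\<close>

lemma (in prob_space) nn_integral_square_normal:
  assumes D: "distributed M lborel X (normal_density \<mu> \<sigma>)" and [arith]: "\<sigma> > 0"
  shows "(\<integral>\<^sup>+\<omega>. ennreal ((X \<omega>)\<^sup>2) \<partial>M) = ennreal (\<mu>\<^sup>2 + \<sigma>\<^sup>2)"
proof -
  have "has_bochner_integral lborel
      (\<lambda>x. normal_density \<mu> \<sigma> x * (x - \<mu>) ^ (2 * 1)
         + 2 * \<mu> * (normal_density \<mu> \<sigma> x * (x - \<mu>) ^ (2 * 0 + 1))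
         + \<mu>\<^sup>2 * (normal_density \<mu> \<sigma> x * (x - \<mu>) ^ (2 * 0)))
      (fact (2 * 1) / ((2 / \<sigma>\<^sup>2) ^ 1 * fact 1) + 2 * \<mu> * 0 + \<mu>\<^sup>2 * (fact (2 * 0) / ((2 / \<sigma>\<^sup>2) ^ 0 * fact 0)))"
    by (intro has_bochner_integral_add has_bochner_integral_mult_right
        normal_moment_even normal_moment_odd) simp_all
  also have "(\<lambda>x. normal_density \<mu> \<sigma> x * (x - \<mu>) ^ (2 * 1)
         + 2 * \<mu> * (normal_density \<mu> \<sigma> x * (x - \<mu>) ^ (2 * 0 + 1))
         + \<mu>\<^sup>2 * (normal_density \<mu> \<sigma> x * (x - \<mu>) ^ (2 * 0))) = (\<lambda>x. normal_density \<mu> \<sigma> x * x\<^sup>2)"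
    by (rule ext) (simp add: power2_eq_square algebra_simps)
  finally have "has_bochner_integral lborel (\<lambda>x. normal_density \<mu> \<sigma> x * x\<^sup>2) (\<mu>\<^sup>2 + \<sigma>\<^sup>2)"
    by (simp add: fact_2 add.commute)
  then have "(\<integral>\<^sup>+x. ennreal (normal_density \<mu> \<sigma> x * x\<^sup>2) \<partial>lborel) = ennreal (\<mu>\<^sup>2 + \<sigma>\<^sup>2)"
    by (subst nn_integral_eq_integral)
       (auto simp: has_bochner_integral_iff normal_density_nonneg)
  moreover have "(\<integral>\<^sup>+\<omega>. ennreal ((X \<omega>)\<^sup>2) \<partial>M) = (\<integral>\<^sup>+x. ennreal (normal_density \<mu> \<sigma> x) * ennreal (x\<^sup>2) \<partial>lborel)"
    by (rule distributed_nn_integral[OF D, symmetric]) simp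
  ultimately show ?thesis by (simp add: ennreal_mult normal_density_nonneg)
qed

text \<open>Independent normals add to a normal whose variance is the sum of the variances, and
  \<open>d\<close> shifts its mean. The nonvanishing conditions keep all standard deviations
  positive, so that \<open>normal_density\<close> is a density.\<close>

lemma nn_integral_square_iid_white_noise_sum:
  fixes v :: "'y::{real_inner,complete_space}"
  assumes \<eta>: "iid_white_noise M \<gamma> \<eta>" and "\<gamma> > 0" "v \<noteq> 0"
    and K: "finite K" "K \<noteq> {}" "K \<subseteq> {1..}" and c: "\<And>k. k \<in> K \<Longrightarrow> c k \<noteq> 0"
  shows "(\<integral>\<^sup>+\<omega>. ennreal ((d + (\<Sum>k\<in>K. c k * \<eta> k v \<omega>))\<^sup>2) \<partial>M)
    = ennreal (d\<^sup>2 + \<gamma>\<^sup>2 * (norm v)\<^sup>2 * (\<Sum>k\<in>K. (c k)\<^sup>2))"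
proof -
  interpret prob_space M using \<eta> by (simp add: iid_white_noise_def)
  let ?s = "\<lambda>k. \<bar>c k\<bar> * (\<gamma> * norm v)"
  \<comment> \<open>Independence of the whole families of pairings passes to their evaluations at
    the single vector \<open>v\<close>.\<close>
  have "indep_vars (\<lambda>_. \<Pi>\<^sub>M v\<in>UNIV. borel) (\<lambda>n \<omega> v. \<eta> n v \<omega>) K"
    using \<eta> K(3) by (auto simp: iid_white_noise_def intro: indep_vars_subset)
  then have "indep_vars (\<lambda>_. borel) (\<lambda>k \<omega>. c k * \<eta> k v \<omega>) K"
    by (rule indep_vars_compose2[where Y="\<lambda>k f. c k * f v"])
       (auto intro!: borel_measurable_times measurable_component_singleton)
  moreover have "distributed M lborel (\<lambda>\<omega>. c k * \<eta> k v \<omega>) (normal_density 0 (?s k))" if "k \<in> K" for k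
  proof -
    have "distributed M lborel (\<eta> k v) (normal_density 0 (\<gamma> * norm v))"
      using \<eta> that K(3) assms(3) by (auto simp: iid_white_noise_def white_noise_def)
    from normal_density_affine[OF this _ c[OF that], of 0] show ?thesis using assms by simp
  qed
  ultimately have "distributed M lborel (\<lambda>\<omega>. \<Sum>k\<in>K. c k * \<eta> k v \<omega>)
      (normal_density (\<Sum>k\<in>K. 0) (sqrt (\<Sum>k\<in>K. (?s k)\<^sup>2)))"
    using assms by (intro sum_indep_normal) auto
  moreover have pos: "(\<Sum>k\<in>K. (?s k)\<^sup>2) > 0"
    using assms by (intro sum_pos) auto
  ultimately have "distributed M lborel (\<lambda>\<omega>. d + 1 * (\<Sum>k\<in>K. c k * \<eta> k v \<omega>))
      (normal_density (d + 1 * (\<Sum>k\<in>K. 0)) (\<bar>1\<bar> * sqrt (\<Sum>k\<in>K. (?s k)\<^sup>2)))"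
    by (intro normal_density_affine) auto
  then have "distributed M lborel (\<lambda>\<omega>. d + (\<Sum>k\<in>K. c k * \<eta> k v \<omega>))
      (normal_density d (sqrt (\<Sum>k\<in>K. (?s k)\<^sup>2)))" by simp
  from nn_integral_square_normal[OF this] pos show ?thesis
    by (simp add: power_mult_distrib sum_distrib_left mult_ac)
qed

text \<open>Unrolls the scalar recursion in which the error coordinate is multiplied by
  \<open>1 - g * k\<close> and receives \<open>g * \<eta> n (A x)\<close>; the starting value
  \<open>- (u \<bullet> x)\<close> reflects the zero initial mean.\<close>

lemma threedvar_error_coordinate:
  fixes A :: "'x::{real_inner,complete_space} \<Rightarrow> 'y::{real_inner,complete_space}"
  assumes A: "bounded_linear A"
    and adj: "adjoint (gain A S \<alpha>) x = g *\<^sub>R A x" "adjoint A (A x) = k *\<^sub>R x"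
    and \<eta>: "iid_white_noise M \<gamma> \<eta>" and y: "\<And>n v \<omega>. n \<ge> 1 \<Longrightarrow> y n v \<omega> = A u \<bullet> v + \<eta> n v \<omega>"
    and \<zeta>: "threedvar M A S \<alpha> y 0 \<zeta>"
  shows "AE \<omega> in M. (\<zeta> n \<omega> - u) \<bullet> x
    = - ((1 - g * k) ^ n * (u \<bullet> x)) + (\<Sum>j=1..n. (1 - g * k) ^ (n - j) * g * \<eta> j (A x) \<omega>)"
proof (induction n)
  case 0
  then show ?case using \<zeta> by (simp add: threedvar_def)
next
  case (Suc n)
  \<comment> \<open>The decoupling: in direction \<open>A x\<close> the innovation sees the error
    only through its coordinate along \<open>x\<close>.\<close>
  have Ainner: "A z \<bullet> A x = k * (z \<bullet> x)" for z
    by (simp add: adjoint_inner[OF A] adj)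
  have "AE \<omega> in M. (\<zeta> (Suc n) \<omega> - \<zeta> n \<omega>) \<bullet> x
      = y (Suc n) (adjoint (gain A S \<alpha>) x) \<omega> - A (\<zeta> n \<omega>) \<bullet> adjoint (gain A S \<alpha>) x"
    using \<zeta> unfolding threedvar_def is_image_def by (elim conjE allE[of _ "Suc n"]) auto
  \<comment> \<open>Linearity of white noise is given for two-term combinations, so scaling is
    obtained with a vanishing second term.\<close>
  moreover have "AE \<omega> in M. \<eta> (Suc n) (g *\<^sub>R A x + 0 *\<^sub>R 0) \<omega> = g * \<eta> (Suc n) (A x) \<omega> + 0 * \<eta> (Suc n) 0 \<omega>"
  proof -
    have "white_noise M \<gamma> (\<eta> (Suc n))" using \<eta> by (simp add: iid_white_noise_def)
    then show ?thesis unfolding white_noise_def by blast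
  qed
  ultimately show ?case using Suc.IH
  proof eventually_elim
    case (elim \<omega>)
    define w where "w = (\<zeta> n \<omega> - u) \<bullet> x"
    let ?r = "1 - g * k"
    have "(\<zeta> (Suc n) \<omega> - u) \<bullet> x = w + (\<zeta> (Suc n) \<omega> - \<zeta> n \<omega>) \<bullet> x"
      by (simp add: w_def inner_diff_left)
    also have "\<dots> = w - g * k * w + g * \<eta> (Suc n) (A x) \<omega>"
      using elim(1,2) by (simp add: adj y Ainner w_def inner_diff_left algebra_simps)
    also have "w - g * k * w = ?r * w" by (simp add: algebra_simps)
    also have "?r * w = - (?r ^ Suc n * (u \<bullet> x)) + (\<Sum>j=1..n. ?r ^ (Suc n - j) * g * \<eta> j (A x) \<omega>)"
    proof -
      have sum: "?r * (\<Sum>j=1..n. ?r ^ (n - j) * g * \<eta> j (A x) \<omega>) = (\<Sum>j=1..n. ?r ^ (Suc n - j) * g * \<eta> j (A x) \<omega>)"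
        unfolding sum_distrib_left by (rule sum.cong) (auto simp: Suc_diff_le mult_ac)
      show ?thesis unfolding w_def elim(3) distrib_left sum by simp
    qed
    finally show ?case by simp
  qed
qed

text \<open>The squared mean gives the first term. The variance is a geometric sum over the noise of
  all steps; its bound \<open>\<gamma>\<^sup>2 * g\<close> is uniform in \<open>n\<close>.\<close>

lemma threedvar_mean_square_coordinate:
  fixes A :: "'x::{real_inner,complete_space} \<Rightarrow> 'y::{real_inner,complete_space}"
  assumes A: "bounded_linear A"
    and adj: "adjoint (gain A S \<alpha>) x = (l / (l * k + \<alpha>)) *\<^sub>R A x" "adjoint A (A x) = k *\<^sub>R x"
    and pos: "l > 0" "k > 0" "\<alpha> > 0" "\<gamma> > 0" and x: "norm x = 1" and n: "n \<ge> 1"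
    and dm: "data_model_1 M A u \<gamma> y" and \<zeta>: "threedvar M A S \<alpha> y 0 \<zeta>"
  shows "(\<integral>\<^sup>+\<omega>. ennreal (((\<zeta> n \<omega> - u) \<bullet> x)\<^sup>2) \<partial>M)
    \<le> ennreal ((\<alpha> / (l * k + \<alpha>)) ^ (2 * n) * (u \<bullet> x)\<^sup>2 + \<gamma>\<^sup>2 * (l / (l * k + \<alpha>)))"
proof -
  obtain \<eta> where \<eta>: "iid_white_noise M \<gamma> \<eta>" and y: "\<And>n v \<omega>. n \<ge> 1 \<Longrightarrow> y n v \<omega> = A u \<bullet> v + \<eta> n v \<omega>"
    using dm by (auto simp: data_model_1_def)
  define g where "g = l / (l * k + \<alpha>)"
  define r where "r = \<alpha> / (l * k + \<alpha>)"
  have lk: "l * k > 0" using pos by simp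
  have r1: "1 - g * k = r"
  proof -
    have "l * k + \<alpha> \<noteq> 0" using lk pos by linarith
    then show ?thesis by (simp add: g_def r_def divide_simps)
  qed
  have r: "0 < r" "r < 1" and g: "g > 0" using lk pos by (auto simp: r_def g_def add_pos_pos)
  have "(norm (A x))\<^sup>2 = k * (norm x)\<^sup>2"
    by (simp add: power2_norm_eq_inner adjoint_inner[OF A] adj)
  then have nA: "(norm (A x))\<^sup>2 = k" using x by simp
  then have "A x \<noteq> 0" using pos by auto
  have "(\<integral>\<^sup>+\<omega>. ennreal (((\<zeta> n \<omega> - u) \<bullet> x)\<^sup>2) \<partial>M) =
      (\<integral>\<^sup>+\<omega>. ennreal ((- (r ^ n * (u \<bullet> x)) + (\<Sum>j\<in>{1..n}. r ^ (n - j) * g * \<eta> j (A x) \<omega>))\<^sup>2) \<partial>M)"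
  proof (rule nn_integral_cong_AE)
    have "AE \<omega> in M. (\<zeta> n \<omega> - u) \<bullet> x
        = - ((1 - g * k) ^ n * (u \<bullet> x)) + (\<Sum>j=1..n. (1 - g * k) ^ (n - j) * g * \<eta> j (A x) \<omega>)"
      by (rule threedvar_error_coordinate[OF A adj[folded g_def] \<eta> _ \<zeta>]) (rule y)
    then show "AE \<omega> in M. ennreal (((\<zeta> n \<omega> - u) \<bullet> x)\<^sup>2)
        = ennreal ((- (r ^ n * (u \<bullet> x)) + (\<Sum>j\<in>{1..n}. r ^ (n - j) * g * \<eta> j (A x) \<omega>))\<^sup>2)"
      unfolding r1 by eventually_elim simp
  qed
  also have "\<dots> = ennreal ((- (r ^ n * (u \<bullet> x)))\<^sup>2 + \<gamma>\<^sup>2 * (norm (A x))\<^sup>2 * (\<Sum>j\<in>{1..n}. (r ^ (n - j) * g)\<^sup>2))"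
    by (rule nn_integral_square_iid_white_noise_sum[OF \<eta>]) (use n r g pos \<open>A x \<noteq> 0\<close> in auto)
  also have "\<dots> \<le> ennreal (r ^ (2 * n) * (u \<bullet> x)\<^sup>2 + \<gamma>\<^sup>2 * g)"
  proof (rule ennreal_leI, rule add_mono)
    have "(\<Sum>j\<in>{1..n}. (r ^ (n - j) * g)\<^sup>2) = g\<^sup>2 * (\<Sum>j<n. (r\<^sup>2) ^ j)"
      unfolding sum_distrib_left
      by (rule sum.reindex_bij_witness[of _ "\<lambda>j. n - j" "\<lambda>j. n - j"])
         (auto simp: power_mult_distrib power_mult[symmetric] mult_ac)
    \<comment> \<open>Passing from ratio \<open>r\<^sup>2\<close> to \<open>r\<close> gives the
      limit \<open>1 / (1 - r)\<close>, and \<open>1 - r = g * k\<close> cancels against the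
      prefactors.\<close>
    also have "(\<Sum>j<n. (r\<^sup>2) ^ j) \<le> (\<Sum>j<n. r ^ j)"
      using r by (intro sum_mono power_mono) (auto simp: power2_eq_square mult_le_one intro: mult_left_le)
    also have "\<dots> = (1 - r ^ n) / (1 - r)" using r by (simp add: sum_gp_strict)
    also have "\<dots> \<le> 1 / (1 - r)" using r by (intro divide_right_mono) auto
    also have "1 - r = g * k" using r1 by simp
    finally have "(\<Sum>j\<in>{1..n}. (r ^ (n - j) * g)\<^sup>2) \<le> g\<^sup>2 * (1 / (g * k))"
      by (simp add: mult_left_mono)
    then have "\<gamma>\<^sup>2 * k * (\<Sum>j\<in>{1..n}. (r ^ (n - j) * g)\<^sup>2) \<le> \<gamma>\<^sup>2 * k * (g\<^sup>2 * (1 / (g * k)))"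
      using pos by (intro mult_left_mono) auto
    also have "\<dots> = \<gamma>\<^sup>2 * g" using g pos by (simp add: power2_eq_square)
    finally show "\<gamma>\<^sup>2 * (norm (A x))\<^sup>2 * (\<Sum>j\<in>{1..n}. (r ^ (n - j) * g)\<^sup>2) \<le> \<gamma>\<^sup>2 * g" by (simp add: nA)
    show "(- (r ^ n * (u \<bullet> x)))\<^sup>2 \<le> r ^ (2 * n) * (u \<bullet> x)\<^sup>2"
      by (simp add: power_mult_distrib power_mult[symmetric] mult.commute)
  qed
  finally show ?thesis by (simp add: r_def g_def)
qed

text \<open>Parseval splits the squared error into coordinates, and for nonnegative terms sum and
  expectation commute. The series is the supremum of its partial sums, so bounds uniform in
  \<open>m\<close> suffice.\<close>

lemma threedvar_mean_square_le:
  fixes A :: "'x::{real_inner,complete_space} \<Rightarrow> 'y::{real_inner,complete_space}"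
  assumes A: "bounded_linear A" and S: "bounded_linear S" and onb: "orthonormal_basis_on {1..} e"
    and eig: "\<And>i. i \<ge> 1 \<Longrightarrow> S (e i) = l i *\<^sub>R e i" "\<And>i. i \<ge> 1 \<Longrightarrow> adjoint A (A (e i)) = k i *\<^sub>R e i"
    and pos: "\<And>i. i \<ge> 1 \<Longrightarrow> l i > 0" "\<And>i. i \<ge> 1 \<Longrightarrow> k i > 0" "\<alpha> > 0" "\<gamma> > 0" and n: "n \<ge> 1"
    and dm: "data_model_1 M A u \<gamma> y" and \<zeta>: "threedvar M A S \<alpha> y 0 \<zeta>"
    and bias: "\<And>m. (\<Sum>i=1..m. (\<alpha> / (l i * k i + \<alpha>)) ^ (2 * n) * (u \<bullet> e i)\<^sup>2) \<le> b"
    and var: "\<And>m. (\<Sum>i=1..m. l i / (l i * k i + \<alpha>)) \<le> v"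
  shows "mean_square M (\<lambda>\<omega>. \<zeta> n \<omega> - u) \<le> ennreal (b + \<gamma>\<^sup>2 * v)"
proof -
  have "\<zeta> n \<in> borel_measurable M" using \<zeta> by (simp add: threedvar_def)
  have meas: "(\<lambda>\<omega>. (\<zeta> n \<omega> - u) \<bullet> x) \<in> borel_measurable M" for x
    by (rule measurable_compose[OF \<open>\<zeta> n \<in> borel_measurable M\<close>])
       (intro borel_measurable_continuous_onI continuous_intros)
  define t where "t i = (\<alpha> / (l i * k i + \<alpha>)) ^ (2 * n) * (u \<bullet> e i)\<^sup>2 + \<gamma>\<^sup>2 * (l i / (l i * k i + \<alpha>))" for i
  have lk: "l i * k i > 0" if "i \<ge> 1" for i using pos(1,2)[OF that] by simp
  have t_nonneg: "t i \<ge> 0" if "i \<ge> 1" for i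
    using lk[OF that] pos(1)[OF that] pos(3) by (simp add: t_def)
  have coord: "(\<integral>\<^sup>+\<omega>. ennreal (((\<zeta> n \<omega> - u) \<bullet> e i)\<^sup>2) \<partial>M) \<le> ennreal (t i)" if i: "i \<ge> 1" for i
  proof -
    note sym = diagonal_operator_symmetric[OF onb S eig(1)]
      and nn = diagonal_operator_nonneg[OF onb S eig(1) less_imp_le[OF pos(1)]]
    have "adjoint (gain A S \<alpha>) (e i) = (l i / (l i * k i + \<alpha>)) *\<^sub>R A (e i)"
      by (rule adjoint_gain_eigenvector[OF A S sym nn pos(3) eig(1)[OF i] eig(2)[OF i] less_imp_le[OF lk[OF i]]])
    moreover have "norm (e i) = 1"
      using onb i by (simp add: orthonormal_basis_on_def norm_eq_1)
    ultimately show ?thesis unfolding t_def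
      by (intro threedvar_mean_square_coordinate[OF A _ eig(2)[OF i] pos(1)[OF i] pos(2)[OF i] pos(3,4) _ n dm \<zeta>])
  qed
  have "mean_square M (\<lambda>\<omega>. \<zeta> n \<omega> - u) = (\<integral>\<^sup>+\<omega>. (\<Sum>i. ennreal (((\<zeta> n \<omega> - u) \<bullet> e (Suc i))\<^sup>2)) \<partial>M)"
    unfolding mean_square_def
    by (intro nn_integral_cong suminf_ennreal_eq[symmetric] parseval[OF onb]) simp
  also have "\<dots> = (\<Sum>i. \<integral>\<^sup>+\<omega>. ennreal (((\<zeta> n \<omega> - u) \<bullet> e (Suc i))\<^sup>2) \<partial>M)"
    using meas by (intro nn_integral_suminf) simp
  also have "\<dots> \<le> (\<Sum>i. ennreal (t (Suc i)))"
    by (intro suminf_le coord) auto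
  also have "\<dots> \<le> ennreal (b + \<gamma>\<^sup>2 * v)"
    unfolding suminf_eq_SUP
  proof (rule SUP_least)
    fix m
    have "(\<Sum>i<m. ennreal (t (Suc i))) = ennreal (\<Sum>i<m. t (Suc i))"
      by (intro sum_ennreal t_nonneg) auto
    also have "(\<Sum>i<m. t (Suc i)) = (\<Sum>i=1..m. t i)"
      by (rule sum.reindex_bij_witness[of _ "\<lambda>i. i - 1" Suc]) auto
    also have "\<dots> \<le> b + \<gamma>\<^sup>2 * v"
      unfolding t_def sum.distrib sum_distrib_left[symmetric] by (intro add_mono bias mult_left_mono var) simp
    finally show "(\<Sum>i<m. ennreal (t (Suc i))) \<le> ennreal (b + \<gamma>\<^sup>2 * v)" by (simp add: ennreal_leI)
  qed
  finally show ?thesis .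
qed

section \<open>Convergence rates for power-law spectra\<close>

theorem theorem6:
  fixes A :: "'x::{real_inner,complete_space} \<Rightarrow> 'y::{real_inner,complete_space}"
    and \<Sigma>\<^sub>0 :: "'x \<Rightarrow> 'x" and u :: 'x and e :: "nat \<Rightarrow> 'x"
    and lam kap :: "nat \<Rightarrow> real" and \<epsilon> p c \<beta> :: real
  assumes "compact_operator A"
    and "assumption_B A \<Sigma>\<^sub>0 u e lam kap \<epsilon> p c \<beta>"
  shows
    "(\<exists>C::real. \<forall>(M::'w measure) (\<gamma>::real) (\<alpha>::real) y \<zeta>.
        \<gamma> > 0 \<longrightarrow> \<alpha> > 0 \<longrightarrow>
        data_model_1 M A u \<gamma> y \<longrightarrow> threedvar M A \<Sigma>\<^sub>0 \<alpha> y 0 \<zeta> \<longrightarrow>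
        (\<forall>n\<ge>1. mean_square M (\<lambda>\<omega>. \<zeta> n \<omega> - u)
           \<le> ennreal (C * (\<alpha> / real n) powr (2 * \<beta> / (1 + 2 * \<epsilon> + 2 * p))
               + C * \<gamma>\<^sup>2 * \<alpha> powr (- ((1 + 2 * p) / (1 + 2 * \<epsilon> + 2 * p))))))
     \<and>
     (\<exists>C'::real. \<forall>(M::'w measure) (\<gamma>::real) (N::nat) y \<zeta>.
        \<gamma> > 0 \<longrightarrow> N \<ge> 2 \<longrightarrow>
        data_model_1 M A u \<gamma> y \<longrightarrow>
        threedvar M A \<Sigma>\<^sub>0 (real N powr (2 * \<beta> / (1 + 2 * \<epsilon> + 2 * \<beta> + 2 * p))) y 0 \<zeta> \<longrightarrow>
        mean_square M (\<lambda>\<omega>. \<zeta> N \<omega> - u)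
          \<le> ennreal (C' * (1 + \<gamma>\<^sup>2)
              * real N powr (- (2 * \<beta> / (1 + 2 * \<epsilon> + 2 * \<beta> + 2 * p))) * ln (real N)))"
proof -
  note B = assms(2)[unfolded assumption_B_def]
  have S: "bounded_linear \<Sigma>\<^sub>0" and onb: "orthonormal_basis_on {1..} e"
    and eig: "\<And>i. i \<ge> 1 \<Longrightarrow> \<Sigma>\<^sub>0 (e i) = lam i *\<^sub>R e i"
      "\<And>i. i \<ge> 1 \<Longrightarrow> adjoint A (A (e i)) = (kap i)\<^sup>2 *\<^sub>R e i"
    and par: "\<epsilon> > 0" "p > 0" "c \<ge> 1" "0 \<le> \<beta>" "\<beta> \<le> 1 + 2 * \<epsilon> + p"
    and lam: "\<And>i. i \<ge> 1 \<Longrightarrow> lam i = real i powr (- 1 - 2 * \<epsilon>)"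
    and kap: "\<And>i. i \<ge> 1 \<Longrightarrow> inverse c * real i powr (- p) \<le> kap i"
    and summ: "(\<lambda>i. (u \<bullet> e i)\<^sup>2 * real i powr (2 * \<beta>)) summable_on {1..}"
    using B by blast+
  have A: "bounded_linear A" using assms(1) by (rule compact_operator_bounded_linear)
  \<comment> \<open>\<open>a\<close> and \<open>b\<close> are the decay exponents of
    \<open>lam i\<close> and of \<open>lam i * (kap i)\<^sup>2\<close>; \<open>\<theta>\<close> is
    the rate in \<open>\<alpha> / n\<close>.\<close>
  define a where "a = 1 + 2 * \<epsilon>"
  define b where "b = 1 + 2 * \<epsilon> + 2 * p"
  define \<theta> where "\<theta> = 2 * \<beta> / b"
  have a: "a > 1" and b: "b > 1" and ab: "a + 2 * p = b" using par by (auto simp: a_def b_def)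
  have \<theta>: "0 \<le> \<theta>" "\<theta> \<le> 2" "b * \<theta> = 2 * \<beta>"
    using par b by (auto simp: \<theta>_def b_def divide_le_eq)
  have lam_eq: "lam i = real i powr (- a)" if "i \<ge> 1" for i
    using lam[OF that] by (simp add: a_def)
  have lam_pos: "lam i > 0" if "i \<ge> 1" for i using that by (simp add: lam_eq)
  have kap2: "c powr (- 2) * real i powr (- (2 * p)) \<le> (kap i)\<^sup>2" if "i \<ge> 1" for i
  proof -
    have "(inverse c * real i powr (- p))\<^sup>2 \<le> (kap i)\<^sup>2"
      using par by (intro power_mono kap that) auto
    moreover have "(inverse c)\<^sup>2 = c powr (- 2)"
      using par by (simp add: powr_minus power_inverse)
    moreover have "(real i powr (- p))\<^sup>2 = real i powr (- (2 * p))"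
      by (simp add: power2_eq_square powr_add[symmetric])
    ultimately show ?thesis by (simp add: power_mult_distrib)
  qed
  have kap2_pos: "(kap i)\<^sup>2 > 0" if "i \<ge> 1" for i
    by (rule less_le_trans[OF _ kap2[OF that]]) (use par that in auto)
  define U where "U = (\<Sum>\<^sub>\<infinity>i\<in>{1..}. (u \<bullet> e i)\<^sup>2 * real i powr (2 * \<beta>))"
  have U: "(\<Sum>i=1..m. (u \<bullet> e i)\<^sup>2 * real i powr (2 * \<beta>)) \<le> U" for m
    unfolding U_def by (rule finite_sum_le_infsum[OF summ]) auto
  have U_nonneg: "U \<ge> 0" using U[of 0] by simp
  \<comment> \<open>Because \<open>b * \<theta> = 2 * \<beta>\<close>, the factor
    \<open>(lam i * (kap i)\<^sup>2) powr (- \<theta>)\<close> is bounded by a constant times the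
    smoothness weight \<open>i powr (2 * \<beta>)\<close>, so the whole sum is controlled by
    \<open>U\<close>.\<close>
  have bias: "(\<Sum>i=1..m. (\<alpha> / (lam i * (kap i)\<^sup>2 + \<alpha>)) ^ (2 * n) * (u \<bullet> e i)\<^sup>2)
      \<le> (\<alpha> / real n) powr \<theta> * (c powr (2 * \<theta>) * U)" if "\<alpha> > 0" "n \<ge> 1" for m n \<alpha>
  proof -
    have "(\<alpha> / (lam i * (kap i)\<^sup>2 + \<alpha>)) ^ (2 * n) * (u \<bullet> e i)\<^sup>2
        \<le> (\<alpha> / real n) powr \<theta> * (c powr (2 * \<theta>) * ((u \<bullet> e i)\<^sup>2 * real i powr (2 * \<beta>)))"
      if i: "i \<ge> 1" for i
    proof -
      have "c powr (- 2) * real i powr (- b) = lam i * (c powr (- 2) * real i powr (- (2 * p)))"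
        by (simp add: lam_eq[OF i] ab[symmetric] powr_add[symmetric])
      also have "\<dots> \<le> lam i * (kap i)\<^sup>2"
        using lam_pos[OF i] by (intro mult_left_mono kap2 i) auto
      finally have "(lam i * (kap i)\<^sup>2) powr (- \<theta>) \<le> (c powr (- 2) * real i powr (- b)) powr (- \<theta>)"
        using \<theta> par i by (intro powr_mono2') auto
      also have "\<dots> = c powr (2 * \<theta>) * real i powr (2 * \<beta>)"
        using par i by (simp add: powr_mult powr_powr \<theta>)
      finally have s: "(lam i * (kap i)\<^sup>2) powr (- \<theta>) \<le> c powr (2 * \<theta>) * real i powr (2 * \<beta>)" .
      have "(\<alpha> / (lam i * (kap i)\<^sup>2 + \<alpha>)) ^ (2 * n)
          \<le> (\<alpha> / real n) powr \<theta> * (lam i * (kap i)\<^sup>2) powr (- \<theta>)"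
        using lam_pos[OF i] kap2_pos[OF i] \<open>\<alpha> > 0\<close> \<open>n \<ge> 1\<close> \<theta>
        by (intro contraction_power_le_powr) auto
      also have "\<dots> \<le> (\<alpha> / real n) powr \<theta> * (c powr (2 * \<theta>) * real i powr (2 * \<beta>))"
        by (intro mult_left_mono s) auto
      finally have "(\<alpha> / (lam i * (kap i)\<^sup>2 + \<alpha>)) ^ (2 * n) * (u \<bullet> e i)\<^sup>2
          \<le> (\<alpha> / real n) powr \<theta> * (c powr (2 * \<theta>) * real i powr (2 * \<beta>)) * (u \<bullet> e i)\<^sup>2"
        by (rule mult_right_mono) simp
      then show ?thesis by (simp add: mult_ac)
    qed
    then have "(\<Sum>i=1..m. (\<alpha> / (lam i * (kap i)\<^sup>2 + \<alpha>)) ^ (2 * n) * (u \<bullet> e i)\<^sup>2)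
        \<le> (\<Sum>i=1..m. (\<alpha> / real n) powr \<theta> * (c powr (2 * \<theta>) * ((u \<bullet> e i)\<^sup>2 * real i powr (2 * \<beta>))))"
      by (intro sum_mono) auto
    also have "\<dots> \<le> (\<alpha> / real n) powr \<theta> * (c powr (2 * \<theta>) * U)"
      unfolding sum_distrib_left[symmetric] by (intro mult_left_mono U) auto
    finally show ?thesis .
  qed
  have var1: "(\<Sum>i=1..m. lam i / (lam i * (kap i)\<^sup>2 + \<alpha>)) \<le> (1 + 1 / (a - 1)) / \<alpha>"
    if "\<alpha> > 0" for m \<alpha>
  proof -
    have "(\<Sum>i=1..m. lam i / (lam i * (kap i)\<^sup>2 + \<alpha>)) \<le> (\<Sum>i=1..m. real i powr (- a)) / \<alpha>"
      unfolding sum_divide_distrib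
    proof (intro sum_mono)
      fix i assume "i \<in> {1..m}"
      then have i: "i \<ge> 1" by simp
      show "lam i / (lam i * (kap i)\<^sup>2 + \<alpha>) \<le> real i powr (- a) / \<alpha>"
        using lam_pos[OF i] \<open>\<alpha> > 0\<close> unfolding lam_eq[OF i, symmetric]
        by (intro divide_left_mono mult_pos_pos) (auto intro: add_nonneg_pos)
    qed
    also have "\<dots> \<le> (1 + 1 / (a - 1)) / \<alpha>"
      using a \<open>\<alpha> > 0\<close> by (intro divide_right_mono sum_powr_le) auto
    finally show ?thesis .
  qed
  define V where "V = c\<^sup>2 * (1 + 2 powr (a - 1) / (a - 1))"
  \<comment> \<open>Dropping \<open>\<alpha>\<close> from the denominator leaves the inverse of
    \<open>(kap i)\<^sup>2\<close>, and dropping the other summand leaves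
    \<open>lam i / \<alpha>\<close>: the two branches of the minimum, with
    \<open>q = 2 * p\<close>.\<close>
  have var2: "(\<Sum>i=1..m. lam i / (lam i * (kap i)\<^sup>2 + \<alpha>)) \<le> V * \<alpha> powr (- ((1 + 2 * p) / b))"
    if "\<alpha> > 0" for m \<alpha>
  proof -
    have "(\<Sum>i=1..m. lam i / (lam i * (kap i)\<^sup>2 + \<alpha>))
        \<le> (\<Sum>i=1..m. c\<^sup>2 * min (real i powr (2 * p)) (real i powr (- a) / \<alpha>))"
    proof (intro sum_mono)
      fix i assume "i \<in> {1..m}"
      then have i: "i \<ge> 1" by simp
      have lk: "lam i * (kap i)\<^sup>2 > 0" using lam_pos[OF i] kap2_pos[OF i] by simp
      have "lam i / (lam i * (kap i)\<^sup>2 + \<alpha>) \<le> lam i / (lam i * (kap i)\<^sup>2)"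
        using lk lam_pos[OF i] \<open>\<alpha> > 0\<close> by (intro divide_left_mono mult_pos_pos) auto
      also have "\<dots> = inverse ((kap i)\<^sup>2)" using lam_pos[OF i] by (simp add: divide_inverse)
      also have "\<dots> \<le> inverse (c powr (- 2) * real i powr (- (2 * p)))"
        using par i by (intro le_imp_inverse_le kap2) auto
      also have "\<dots> = c\<^sup>2 * real i powr (2 * p)"
        using par by (simp add: powr_minus)
      finally have 1: "lam i / (lam i * (kap i)\<^sup>2 + \<alpha>) \<le> c\<^sup>2 * real i powr (2 * p)" .
      have "lam i / (lam i * (kap i)\<^sup>2 + \<alpha>) \<le> lam i / \<alpha>"
        using lk lam_pos[OF i] \<open>\<alpha> > 0\<close> by (intro divide_left_mono mult_pos_pos) auto
      \<comment> \<open>The factor \<open>c\<^sup>2 \<ge> 1\<close> is inserted so that both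
        branches share one constant.\<close>
      also have "\<dots> \<le> c\<^sup>2 * (lam i / \<alpha>)"
        using mult_right_mono[of 1 "c\<^sup>2" "lam i / \<alpha>"] par lam_pos[OF i] \<open>\<alpha> > 0\<close> by (simp add: one_le_power)
      finally have 2: "lam i / (lam i * (kap i)\<^sup>2 + \<alpha>) \<le> c\<^sup>2 * (real i powr (- a) / \<alpha>)"
        by (simp add: lam_eq[OF i])
      from 1 2 show "lam i / (lam i * (kap i)\<^sup>2 + \<alpha>) \<le> c\<^sup>2 * min (real i powr (2 * p)) (real i powr (- a) / \<alpha>)"
        by (simp add: min_def)
    qed
    also have "\<dots> \<le> c\<^sup>2 * ((1 + 2 powr (a - 1) / (a - 1)) * \<alpha> powr (- ((2 * p + 1) / (a + 2 * p))))"
      unfolding sum_distrib_left[symmetric]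
      using a par that by (intro mult_left_mono sum_min_powr_le) auto
    also have "\<dots> = V * \<alpha> powr (- ((1 + 2 * p) / b))" by (simp add: V_def ab add.commute)
    finally show ?thesis .
  qed
  note mse = threedvar_mean_square_le[OF A S onb eig lam_pos kap2_pos]
  define W where "W = c powr (2 * \<theta>) * U"
  have W: "W \<ge> 0" using U_nonneg by (simp add: W_def)
  show ?thesis
  proof (rule conjI)
    show "\<exists>C::real. \<forall>(M::'w measure) (\<gamma>::real) (\<alpha>::real) y \<zeta>.
        \<gamma> > 0 \<longrightarrow> \<alpha> > 0 \<longrightarrow>
        data_model_1 M A u \<gamma> y \<longrightarrow> threedvar M A \<Sigma>\<^sub>0 \<alpha> y 0 \<zeta> \<longrightarrow>
        (\<forall>n\<ge>1. mean_square M (\<lambda>\<omega>. \<zeta> n \<omega> - u)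
           \<le> ennreal (C * (\<alpha> / real n) powr (2 * \<beta> / (1 + 2 * \<epsilon> + 2 * p))
               + C * \<gamma>\<^sup>2 * \<alpha> powr (- ((1 + 2 * p) / (1 + 2 * \<epsilon> + 2 * p)))))"
      unfolding b_def[symmetric] \<theta>_def[symmetric]
    proof (intro exI[of _ "max W V"] allI impI)
      fix M :: "'w measure" and \<gamma> \<alpha> :: real and y \<zeta> and n :: nat
      assume "\<gamma> > 0" "\<alpha> > 0" "data_model_1 M A u \<gamma> y" "threedvar M A \<Sigma>\<^sub>0 \<alpha> y 0 \<zeta>" "n \<ge> 1"
      note h = this
      have "mean_square M (\<lambda>\<omega>. \<zeta> n \<omega> - u)
          \<le> ennreal ((\<alpha> / real n) powr \<theta> * W + \<gamma>\<^sup>2 * (V * \<alpha> powr (- ((1 + 2 * p) / b))))"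
        unfolding W_def
        by (rule mse[OF _ _ _ _ h(2) h(1) h(5) h(3) h(4) bias[OF h(2) h(5)] var2[OF h(2)]])
      also have "\<dots> \<le> ennreal (max W V * (\<alpha> / real n) powr \<theta> + max W V * \<gamma>\<^sup>2 * \<alpha> powr (- ((1 + 2 * p) / b)))"
      proof (intro ennreal_leI add_mono)
        show "(\<alpha> / real n) powr \<theta> * W \<le> max W V * (\<alpha> / real n) powr \<theta>"
          by (simp add: mult.commute[of _ W] mult_right_mono)
        have "\<gamma>\<^sup>2 * \<alpha> powr (- ((1 + 2 * p) / b)) * V \<le> \<gamma>\<^sup>2 * \<alpha> powr (- ((1 + 2 * p) / b)) * max W V"
          by (intro mult_left_mono) auto
        then show "\<gamma>\<^sup>2 * (V * \<alpha> powr (- ((1 + 2 * p) / b))) \<le> max W V * \<gamma>\<^sup>2 * \<alpha> powr (- ((1 + 2 * p) / b))"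
          by (simp add: mult_ac)
      qed
      finally show "mean_square M (\<lambda>\<omega>. \<zeta> n \<omega> - u)
          \<le> ennreal (max W V * (\<alpha> / real n) powr \<theta> + max W V * \<gamma>\<^sup>2 * \<alpha> powr (- ((1 + 2 * p) / b)))" .
    qed
    define D where "D = 1 + 1 / (a - 1)"
    define \<tau> where "\<tau> = 2 * \<beta> / (1 + 2 * \<epsilon> + 2 * \<beta> + 2 * p)"
    \<comment> \<open>The balance behind the choice of \<open>\<alpha>\<close>: since
      \<open>\<alpha> / N = N powr (\<tau> - 1)\<close>, the bias rate
      \<open>(\<alpha> / N) powr \<theta>\<close> and the variance rate \<open>1 / \<alpha>\<close>
      both equal \<open>N powr (- \<tau>)\<close>.\<close>
    have \<tau>: "(\<tau> - 1) * \<theta> = - \<tau>"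
    proof -
      have "b + 2 * \<beta> > 0" "b \<noteq> 0" using b par by auto
      moreover have "\<tau> = 2 * \<beta> / (b + 2 * \<beta>)" by (simp add: \<tau>_def b_def add_ac)
      ultimately show ?thesis by (simp add: \<theta>_def field_simps)
    qed
    show "\<exists>C'::real. \<forall>(M::'w measure) (\<gamma>::real) (N::nat) y \<zeta>.
        \<gamma> > 0 \<longrightarrow> N \<ge> 2 \<longrightarrow>
        data_model_1 M A u \<gamma> y \<longrightarrow>
        threedvar M A \<Sigma>\<^sub>0 (real N powr (2 * \<beta> / (1 + 2 * \<epsilon> + 2 * \<beta> + 2 * p))) y 0 \<zeta> \<longrightarrow>
        mean_square M (\<lambda>\<omega>. \<zeta> N \<omega> - u)
          \<le> ennreal (C' * (1 + \<gamma>\<^sup>2)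
              * real N powr (- (2 * \<beta> / (1 + 2 * \<epsilon> + 2 * \<beta> + 2 * p))) * ln (real N))"
      unfolding \<tau>_def[symmetric]
    proof (intro exI[of _ "max W D / ln 2"] allI impI)
      fix M :: "'w measure" and \<gamma> :: real and y \<zeta> and N :: nat
      assume "\<gamma> > 0" "N \<ge> 2" "data_model_1 M A u \<gamma> y" "threedvar M A \<Sigma>\<^sub>0 (real N powr \<tau>) y 0 \<zeta>"
      note h = this
      define \<alpha> where "\<alpha> = real N powr \<tau>"
      have \<alpha>: "\<alpha> > 0" and N: "N \<ge> 1" using h(2) by (auto simp: \<alpha>_def)
      have "\<alpha> / real N = real N powr (\<tau> - 1)"
        using N by (simp add: \<alpha>_def powr_diff)
      then have e1: "(\<alpha> / real N) powr \<theta> = real N powr (- \<tau>)"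
        by (simp add: powr_powr \<tau>)
      have e2: "1 / \<alpha> = real N powr (- \<tau>)" by (simp add: \<alpha>_def powr_minus divide_inverse)
      have "mean_square M (\<lambda>\<omega>. \<zeta> N \<omega> - u) \<le> ennreal ((\<alpha> / real N) powr \<theta> * W + \<gamma>\<^sup>2 * (D / \<alpha>))"
        unfolding W_def D_def
        by (rule mse[OF _ _ _ _ \<alpha> h(1) N h(3) h(4)[folded \<alpha>_def] bias[OF \<alpha> N] var1[OF \<alpha>]])
      also have "\<dots> \<le> ennreal (max W D / ln 2 * (1 + \<gamma>\<^sup>2) * real N powr (- \<tau>) * ln (real N))"
      proof (rule ennreal_leI)
        have "(\<alpha> / real N) powr \<theta> * W + \<gamma>\<^sup>2 * (D / \<alpha>) = (W + \<gamma>\<^sup>2 * D) * real N powr (- \<tau>)"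
          unfolding e1 using e2 by (simp add: divide_inverse algebra_simps)
        also have "\<dots> \<le> (max W D + \<gamma>\<^sup>2 * max W D) * real N powr (- \<tau>)"
          by (intro mult_right_mono add_mono mult_left_mono) auto
        also have "\<dots> = max W D * (1 + \<gamma>\<^sup>2) * real N powr (- \<tau>) * 1" by (simp add: algebra_simps)
        \<comment> \<open>\<open>N \<ge> 2\<close> gives \<open>ln N / ln 2 \<ge> 1\<close>; this is
          where the logarithm enters and why the constant is divided by \<open>ln 2\<close>.\<close>
        also have "\<dots> \<le> max W D * (1 + \<gamma>\<^sup>2) * real N powr (- \<tau>) * (ln (real N) / ln 2)"
          using h(2) W by (intro mult_left_mono mult_nonneg_nonneg) auto
        finally show "(\<alpha> / real N) powr \<theta> * W + \<gamma>\<^sup>2 * (D / \<alpha>)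
            \<le> max W D / ln 2 * (1 + \<gamma>\<^sup>2) * real N powr (- \<tau>) * ln (real N)" by simp
      qed
      finally show "mean_square M (\<lambda>\<omega>. \<zeta> N \<omega> - u)
          \<le> ennreal (max W D / ln 2 * (1 + \<gamma>\<^sup>2) * real N powr (- \<tau>) * ln (real N))" .
    qed
  qed
qed

end
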